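(* Let $\ell\ge 2$, let $t_1,\dots,t_{\ell-1}$ and $s$ be positive integers, let $V=\{2s,\,2(s+t_1),\,\dots,\,2(s+t_1+\cdots+t_{\ell-1})\}$ and let $m\ge\max(V)$ be an integer. Put $p=\frac{m}{2}$ if $m$ is even and $p=m$ if $m$ is odd. If the sequence $(t_1,\dots,t_{\ell-1})$ is primitive, then the sequence $H(D^{(m,V)})$ is periodic with a period of either $p$ or $2p$. Moreover, the periodicity is $p$ if $\prod_{j=1}^{\ell-2}h(t_1,\dots,t_j)=-1$, and is $2p$ if $\prod_{j=1}^{\ell-2}h(t_1,\dots,t_j)=1$.
   Context: For an integer $m\ge 2$ and $V\subseteq[m]=\{1,\dots,m\}$, let $(m,V)=\{k\in\mathbb{Z}^+ : k\equiv j \pmod m \text{ for some } j\in V\}$. A Dyck path of size $n$ is a lattice path from $(0,0)$ to $(2n,0)$ with steps $(1,1)$ and $(1,-1)$ never going below the $x$-axis; a peak is an up-step immediately followed by a down-step, and its height is the $y$-coordinate of the point between them. Let $d_n^{(m,V)}$ be the number of Dyck paths of size $n$ none of whose peaks has height in $(m,V)$, and $D^{(m,V)}(x)=\sum_{n\ge0}d_n^{(m,V)}x^n$. For a power series $F=\sum f_nx^n$ and $n\ge1$, $H_n(F)=\det(f_{i+j})_{0\le i,j\le n-1}$ and $H(F)=(H_1(F),H_2(F),\dots)$. A sequence $(a_n)_{n\ge1}$ has period $q$ if $a_{n+q}=a_n$ for all $n\ge1$. For positive integers $t_1,t_2,\dots$ define rationals $h(t_1)=2-t_1$ and $h(t_1,\dots,t_j)=2-t_j-1/h(t_1,\dots,t_{j-1})$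 for $j\ge2$. A sequence $(t_1,\dots,t_b)$ ($b\ge0$) of positive integers is admissible if $h(t_1),h(t_1,t_2),\dots,h(t_1,\dots,t_b)$ are all nonzero (the empty sequence is admissible). A sequence $(t_1,\dots,t_{b+1})$ of positive integers is primitive if $(t_1,\dots,t_b)$ is admissible and $h(t_1,\dots,t_{b+1})=2-t_{b+1}-1/h(t_1,\dots,t_b)=0$. (An empty product equals $1$.) *)

theory Defs
  imports
    "Jordan_Normal_Form.Determinant"
    "HOL-Computational_Algebra.Formal_Power_Series"
    "HOL-Number_Theory.Cong"
begin

datatype step = Up | Down

fun step_val :: "step \<Rightarrow> int" where
  "step_val Up = 1"
| "step_val Down = -1"

definition end_height :: "step list \<Rightarrow> int" where
  "end_height w = (\<Sum>x\<leftarrow>w. step_val x)"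

definition dyck_paths :: "nat \<Rightarrow> step list set" where
  "dyck_paths n = {w. length w = 2 * n \<and> end_height w = 0 \<and>
     (\<forall>k\<le>2 * n. end_height (take k w) \<ge> 0)}"

definition peak_heights :: "step list \<Rightarrow> int set" where
  "peak_heights w = {end_height (take (Suc i) w) | i.
     Suc i < length w \<and> w ! i = Up \<and> w ! Suc i = Down}"

definition residue_set :: "nat \<Rightarrow> nat set \<Rightarrow> nat set" where
  "residue_set m V = {k. k > 0 \<and> (\<exists>j\<in>V. [k = j] (mod m))}"

definition restricted_dyck_count :: "nat \<Rightarrow> nat set \<Rightarrow> nat \<Rightarrow> nat" where
  "restricted_dyck_count m V n =
     card {w \<in> dyck_paths n. peak_heights w \<inter> int ` residue_set m V = {}}"

definition restricted_dyck_fps :: "nat \<Rightarrow> nat set \<Rightarrow> int fps" where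
  "restricted_dyck_fps m V = Abs_fps (\<lambda>n. int (restricted_dyck_count m V n))"

definition hankel_det :: "'a::comm_ring_1 fps \<Rightarrow> nat \<Rightarrow> 'a" where
  "hankel_det F n = det (mat n n (\<lambda>(i, j). fps_nth F (i + j)))"

text \<open>Sequences \<open>(a\<^sub>n)\<close> with \<open>n \<ge> 1\<close> are functions on \<open>nat\<close> whose value at 0 is ignored;
  a period need not be the least one.\<close>

definition has_period :: "nat \<Rightarrow> (nat \<Rightarrow> 'a) \<Rightarrow> bool" where
  "has_period q a \<longleftrightarrow> (\<forall>n\<ge>1. a (n + q) = a n)"

text \<open>A finite sequence \<open>(t\<^sub>1, \<dots>, t\<^sub>b)\<close> is a function \<open>t\<close> together with its length \<open>b\<close>, and
  \<open>seq_h t j\<close> is \<open>h(t\<^sub>1, \<dots>, t\<^sub>j)\<close>; the value at \<open>j = 0\<close> is a dummy.\<close>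

fun seq_h :: "(nat \<Rightarrow> nat) \<Rightarrow> nat \<Rightarrow> rat" where
  "seq_h t 0 = 0"
| "seq_h t (Suc 0) = 2 - of_nat (t 1)"
| "seq_h t (Suc (Suc j)) = 2 - of_nat (t (Suc (Suc j))) - 1 / seq_h t (Suc j)"

definition admissible_seq :: "(nat \<Rightarrow> nat) \<Rightarrow> nat \<Rightarrow> bool" where
  "admissible_seq t b \<longleftrightarrow> (\<forall>j\<in>{1..b}. t j > 0) \<and> (\<forall>j\<in>{1..b}. seq_h t j \<noteq> 0)"

definition primitive_seq :: "(nat \<Rightarrow> nat) \<Rightarrow> nat \<Rightarrow> bool" where
  "primitive_seq t k \<longleftrightarrow> k \<ge> 1 \<and> (\<forall>j\<in>{1..k}. t j > 0) \<and>
     admissible_seq t (k - 1) \<and> seq_h t k = 0"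

end

theory Submission
  imports Defs
begin

text \<open>Let \<open>F\<^sub>k\<close> count the restricted paths above height \<open>k\<close>, and let \<open>e\<^sub>k\<close> be 1 if height \<open>k\<close> is
  forbidden and 0 otherwise. The first-return decomposition gives \<open>F\<^sub>k (1 + e\<^sub>k\<^sub>+\<^sub>1 x - x F\<^sub>k\<^sub>+\<^sub>1) = 1\<close>.
  As long as no odd height is forbidden, \<open>F\<^sub>2\<^sub>k = 1 + x G\<^sub>k\<close> with
  \<open>1 / G\<^sub>k = 1 - (2 - e\<^sub>2\<^sub>k\<^sub>+\<^sub>2) x - x\<^sup>2 G\<^sub>k\<^sub>+\<^sub>1\<close>, and the Hankel determinants of \<open>F\<^sub>0\<close> are controlled by
  the recurrence \<open>P\<^sub>k = (2 - e\<^sub>2\<^sub>k) P\<^sub>k\<^sub>-\<^sub>1 - P\<^sub>k\<^sub>-\<^sub>2\<close>, \<open>P\<^sub>0 = P\<^sub>-\<^sub>1 = 1\<close>. Sampled at the forbidden heights,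
  \<open>P\<^sub>k - P\<^sub>k\<^sub>-\<^sub>1\<close> is minus the product of the \<open>h(t\<^sub>1, \<dots>, t\<^sub>j)\<close>. So primitivity says that right after the
  last forbidden even height both \<open>P\<^sub>k\<close> and \<open>P\<^sub>k\<^sub>-\<^sub>1\<close> equal \<open>\<sigma> = -h(t\<^sub>1) \<cdots> h(t\<^sub>1, \<dots>, t\<^sub>l\<^sub>-\<^sub>2)\<close>, an integer
  unit. From there on, whether or not odd heights are forbidden, each two levels only shift the
  index of the Hankel determinant by one. After \<open>2p\<close> levels \<open>F\<^sub>0\<close> recurs, whence
  \<open>H\<^sub>n\<^sub>+\<^sub>p = \<sigma> H\<^sub>n\<close>.\<close>

section \<open>First-return decomposition\<close>

definition dyck :: "step list \<Rightarrow> bool" where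
  "dyck w \<longleftrightarrow> end_height w = 0 \<and> (\<forall>k. 0 \<le> end_height (take k w))"

lemma end_height_Nil [simp]: "end_height [] = 0"
  and end_height_Cons [simp]: "end_height (x # w) = step_val x + end_height w"
  and end_height_append [simp]: "end_height (w @ w') = end_height w + end_height w'"
  by (simp_all add: end_height_def)

lemma dyck_paths_eq: "dyck_paths n = {w. length w = 2 * n \<and> dyck w}"
proof -
  have "(\<forall>k\<le>length w. 0 \<le> end_height (take k w)) \<longleftrightarrow> (\<forall>k. 0 \<le> end_height (take k w))" for w
    by (metis nle_le order_refl take_all)
  then show ?thesis
    unfolding dyck_paths_def dyck_def by (metis (no_types, lifting))
qed

lemma dyck_prefix: "dyck (a @ b) \<Longrightarrow> 0 \<le> end_height a"
  unfolding dyck_def by (metis append_eq_conv_conj)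

lemma dyck_Nil [simp]: "dyck []"
  by (simp add: dyck_def)

lemma even_length_dyck: "dyck w \<Longrightarrow> even (length w)"
proof -
  have "even (end_height w + int (length w))" for w
  proof (induction w)
    case (Cons x w)
    then show ?case by (cases x) simp_all
  qed simp
  then show "dyck w \<Longrightarrow> even (length w)"
    by (metis dyck_def add_0 even_of_nat)
qed

text \<open>Cut at the shortest prefix of negative height: heights change by one, so its last step
  is \<open>Down\<close> and what precedes it ends at height 0.\<close>

lemma first_passage:
  assumes "end_height (take k w) < 0"
  shows "\<exists>u v. w = u @ Down # v \<and> dyck u"
proof -
  define n where "n = (LEAST k. end_height (take k w) < 0)"
  have n: "end_height (take n w) < 0"
    unfolding n_def using assms by (rule LeastI)
  have least: "0 \<le> end_height (take j w)" if "j < n" for j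
    using not_less_Least[of j "\<lambda>k. end_height (take k w) < 0"] that by (auto simp: n_def)
  obtain j where j: "n = Suc j"
    using n by (cases n) auto
  have len: "j < length w"
    using n least[of j] j by (metis lessI linorder_not_less nle_le not_less_eq_eq take_all)
  have take_n: "take n w = take j w @ [w ! j]"
    using j len by (simp add: take_Suc_conv_app_nth)
  have "w ! j = Down" and "end_height (take j w) = 0"
    using n least[of j] j take_n by (cases "w ! j"; simp)+
  moreover have "0 \<le> end_height (take i (take j w))" for i
    using least[of "min i j"] j by (auto simp: min_def)
  ultimately have "dyck (take j w)"
    by (auto simp: dyck_def)
  moreover have "w = take j w @ Down # drop n w"
    using len j \<open>w ! j = Down\<close> by (metis id_take_nth_drop)
  ultimately show ?thesis by blast
qed

lemma dyck_decompose:
  assumes "dyck w" "w \<noteq> []"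
  shows "\<exists>u v. w = Up # u @ Down # v \<and> dyck u \<and> dyck v"
proof -
  obtain x w' where w: "w = x # w'"
    using assms by (cases w) auto
  have "0 \<le> end_height [x]"
    using dyck_prefix[of "[x]" w'] assms w by simp
  then have x: "x = Up"
    by (cases x) auto
  \<comment> \<open>Without its leading \<open>Up\<close> the path ends at -1; its first
    \<open>Down\<close> to -1 is the first return of \<open>w\<close> to 0.\<close>
  have "end_height (take (length w') w') < 0"
    using assms w x by (simp add: dyck_def)
  then obtain u v where uv: "w' = u @ Down # v" "dyck u"
    using first_passage by blast
  have "0 \<le> end_height (take k v)" for k
    using dyck_prefix[of "Up # u @ Down # take k v" "drop k v"] assms(1) w x uv
    by (simp add: dyck_def)
  then have "dyck v"
    using assms(1) w x uv by (simp add: dyck_def)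
  then show ?thesis
    using w x uv by auto
qed

lemma dyck_compose:
  assumes "dyck u" "dyck v"
  shows "dyck (Up # u @ Down # v)"
proof -
  have "0 \<le> end_height (take k (Up # u @ Down # v))" for k
  proof (cases k)
    case (Suc j)
    have "- 1 \<le> end_height (take j u)" "0 \<le> end_height (take (j - Suc (length u)) v)"
      using assms by (auto simp: dyck_def intro: order_trans[of _ 0])
    then show ?thesis
      using assms Suc by (cases "j - length u") (auto simp: dyck_def)
  qed simp
  then show ?thesis
    using assms by (simp add: dyck_def)
qed

text \<open>Otherwise the shorter Dyck path followed by \<open>Down\<close> would be a prefix of the
  longer one, at height -1.\<close>

lemma dyck_decompose_unique:
  assumes "u @ Down # v = u' @ Down # v'" "dyck u" "dyck u'"
  shows "u = u' \<and> v = v'"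
proof -
  have "False" if "a @ Down # b = a' @ Down # b'" "length a < length a'" "dyck a" "dyck a'" for a b a' b'
  proof -
    from that obtain c where c: "a' = a @ c" "Down # b = c @ Down # b'"
      by (auto simp: append_eq_append_conv2)
    with that obtain d where "c = Down # d"
      by (cases c) auto
    then show False
      using c that dyck_prefix[of "a @ [Down]" d] by (simp add: dyck_def)
  qed
  then have "length u = length u'"
    using assms by (metis linorder_neqE_nat)
  then show ?thesis
    using assms by simp
qed

section \<open>Peak heights under concatenation and first-return decomposition\<close>

lemma peak_heights_append:
  "peak_heights (xs @ ys) = peak_heights xs \<union> (+) (end_height xs) ` peak_heights ys \<union>
     (if xs \<noteq> [] \<and> ys \<noteq> [] \<and> last xs = Up \<and> hd ys = Down then {end_height xs} else {})"
    (is "?L = ?A \<union> ?B \<union> ?C")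
proof -
  let ?w = "xs @ ys" and ?n = "length xs"
  let ?P = "\<lambda>i. Suc i < length ?w \<and> ?w ! i = Up \<and> ?w ! Suc i = Down"
  let ?h = "\<lambda>i. end_height (take (Suc i) ?w)"
  have "?L = ?h ` {i. ?P i}"
    by (auto simp: peak_heights_def)
  also have "{i. ?P i} = {i. ?P i \<and> Suc i < ?n} \<union> {i. ?P i \<and> ?n \<le> i} \<union> {i. ?P i \<and> Suc i = ?n}"
    by auto
  also have "?h ` \<dots> = ?h ` {i. ?P i \<and> Suc i < ?n} \<union> ?h ` {i. ?P i \<and> ?n \<le> i} \<union> ?h ` {i. ?P i \<and> Suc i = ?n}"
    by (simp add: image_Un)
  also have "?h ` {i. ?P i \<and> Suc i < ?n} = ?A"
    by (force simp: peak_heights_def nth_append image_iff)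
  also have "?h ` {i. ?P i \<and> ?n \<le> i} = ?B"
  proof -
    have "{i. ?P i \<and> ?n \<le> i} = (+) ?n ` {i. Suc i < length ys \<and> ys ! i = Up \<and> ys ! Suc i = Down}"
      by (auto simp: nth_append image_iff le_iff_add)
    moreover have "?h (?n + i) = end_height xs + end_height (take (Suc i) ys)" for i
      by (simp flip: add_Suc_right)
    ultimately show ?thesis
      by (auto simp: peak_heights_def image_iff simp flip: add_Suc_right)
  qed
  also have "?h ` {i. ?P i \<and> Suc i = ?n} = ?C"
  proof (cases "xs = [] \<or> ys = []")
    case False
    then obtain a x y b where "xs = a @ [x]" "ys = y # b"
      by (metis neq_Nil_conv rev_exhaust)
    then have "{i. ?P i \<and> Suc i = ?n} = (if x = Up \<and> y = Down then {length a} else {})"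
      by (auto simp: nth_append)
    with \<open>xs = a @ [x]\<close> \<open>ys = y # b\<close> show ?thesis
      by (simp split: if_splits)
  qed auto
  finally show ?thesis .
qed

lemma peak_heights_Nil [simp]: "peak_heights [] = {}"
  and peak_heights_single [simp]: "peak_heights [x] = {}"
  by (simp_all add: peak_heights_def)

lemma hd_dyck: "dyck u \<Longrightarrow> u \<noteq> [] \<Longrightarrow> hd u = Up"
  using dyck_decompose by fastforce

lemma last_dyck: "dyck u \<Longrightarrow> u \<noteq> [] \<Longrightarrow> last u = Down"
proof (induction "length u" arbitrary: u rule: less_induct)
  case less
  then obtain a b where "u = Up # a @ Down # b" "dyck b"
    using dyck_decompose by blast
  then show ?case
    using less.hyps[of b] by (cases "b = []") simp_all
qed

text \<open>A nonempty Dyck path starts with \<open>Up\<close> and ends with \<open>Down\<close>, so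
  the seams create no peak; only an empty \<open>u\<close> does, at height 1.\<close>

lemma peak_heights_compose:
  assumes "dyck u" "dyck v"
  shows "peak_heights (Up # u @ Down # v) =
    (if u = [] then {1} else (+) 1 ` peak_heights u) \<union> peak_heights v"
proof -
  have v: "peak_heights (Down # v) = (+) (- 1) ` peak_heights v"
    using peak_heights_append[of "[Down]" v] by simp
  have uv: "peak_heights (u @ Down # v) = peak_heights u \<union> peak_heights (Down # v)"
    using peak_heights_append[of u "Down # v"] last_dyck[of u] assms by (auto simp: dyck_def)
  show ?thesis
    using peak_heights_append[of "[Up]" "u @ Down # v"] hd_dyck[of u] assms
    by (auto simp: uv v image_Un image_image)
qed

lemma peak_heights_pos:
  assumes "dyck w" "h \<in> peak_heights w"
  shows "h \<ge> 1"
  using assms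
proof (induction "length w" arbitrary: w h rule: less_induct)
  case less
  then have "w \<noteq> []" by auto
  then obtain u v where uv: "w = Up # u @ Down # v" "dyck u" "dyck v"
    using dyck_decompose less.prems by blast
  then show ?case
    using less.hyps[of u] less.hyps[of v] less.prems
    by (force simp: peak_heights_compose split: if_splits)
qed

section \<open>Generating series of Dyck paths with restricted peaks\<close>

definition peak_dyck :: "(int \<Rightarrow> bool) \<Rightarrow> nat \<Rightarrow> step list set" where
  "peak_dyck P n = {w \<in> dyck_paths n. \<forall>h\<in>peak_heights w. P h}"

definition peak_dyck_fps :: "(int \<Rightarrow> bool) \<Rightarrow> int fps" where
  "peak_dyck_fps P = Abs_fps (\<lambda>n. int (card (peak_dyck P n)))"

lemma finite_peak_dyck [simp]: "finite (peak_dyck P n)"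
proof -
  have "finite {w. set w \<subseteq> {Up, Down} \<and> length w = 2 * n}"
    by (rule finite_lists_length_eq) simp
  moreover have "peak_dyck P n \<subseteq> {w. set w \<subseteq> {Up, Down} \<and> length w = 2 * n}"
    using step.exhaust by (auto simp: peak_dyck_def dyck_paths_eq)
  ultimately show ?thesis
    by (rule rev_finite_subset)
qed

lemma peak_dyck_0 [simp]: "peak_dyck P 0 = {[]}"
  by (auto simp: peak_dyck_def dyck_paths_eq)

text \<open>The inner path \<open>u\<close> lives one level higher, hence the shifted predicate. An
  empty \<open>u\<close> makes a peak at height 1, so it is removed when \<open>P 1\<close>
  fails.\<close>

lemma peak_dyck_Suc:
  "bij_betw (\<lambda>(i, u, v). Up # u @ Down # v)
     (SIGMA i:{..n}. (peak_dyck (\<lambda>h. P (h + 1)) i - (if P 1 then {} else {[]})) \<times> peak_dyck P (n - i))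
     (peak_dyck P (Suc n))" (is "bij_betw ?f ?S ?T")
proof (rule bij_betw_imageI)
  show "inj_on ?f ?S"
    by (auto intro!: inj_onI dest: dyck_decompose_unique simp: peak_dyck_def dyck_paths_eq)
  show "?f ` ?S = ?T"
  proof (intro equalityI subsetI)
    fix w assume "w \<in> ?f ` ?S"
    then show "w \<in> ?T"
      by (auto simp: peak_dyck_def dyck_paths_eq dyck_compose peak_heights_compose add.commute split: if_splits)
  next
    fix w assume w: "w \<in> ?T"
    then have "dyck w" "w \<noteq> []"
      by (auto simp: peak_dyck_def dyck_paths_eq)
    then obtain u v where uv: "w = Up # u @ Down # v" "dyck u" "dyck v"
      using dyck_decompose by blast
    obtain i j where ij: "length u = 2 * i" "length v = 2 * j"
      using even_length_dyck uv by (metis evenE)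
    with uv w have "i + j = n"
      by (auto simp: peak_dyck_def dyck_paths_eq)
    with uv w ij have "(i, u, v) \<in> ?S"
      by (auto simp: peak_dyck_def dyck_paths_eq peak_heights_compose add.commute split: if_splits)
    then show "w \<in> ?f ` ?S"
      using uv by (force simp: image_iff)
  qed
qed

lemma card_peak_dyck_Suc:
  "int (card (peak_dyck P (Suc n))) =
     (\<Sum>i\<le>n. (int (card (peak_dyck (\<lambda>h. P (h + 1)) i)) - (if i = 0 \<and> \<not> P 1 then 1 else 0))
            * int (card (peak_dyck P (n - i))))"
proof -
  have "int (card (peak_dyck Q i - (if b then {} else {[]}))) =
      int (card (peak_dyck Q i)) - (if i = 0 \<and> \<not> b then 1 else 0)" for Q i b
  proof (cases "i = 0")
    case False
    then have "[] \<notin> peak_dyck Q i"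
      by (auto simp: peak_dyck_def dyck_paths_eq)
    then show ?thesis using False by simp
  qed auto
  then show ?thesis
    by (subst bij_betw_same_card[OF peak_dyck_Suc, symmetric])
      (simp add: card_SigmaI card_cartesian_product)
qed

lemma peak_dyck_fps_eq:
  "peak_dyck_fps P * (1 + fps_const (if P 1 then 0 else 1) * fps_X
     - fps_X * peak_dyck_fps (\<lambda>h. P (h + 1))) = 1"
proof -
  let ?F = "peak_dyck_fps P" and ?G = "peak_dyck_fps (\<lambda>h. P (h + 1))"
  let ?H = "?G - fps_const (if P 1 then 0 else 1)"
  have "fps_nth ?F (Suc k) = fps_nth (?H * ?F) k" for k
    unfolding fps_mult_nth atLeast0AtMost
    by (simp add: peak_dyck_fps_def card_peak_dyck_Suc)
  then have "?F = 1 + fps_X * (?H * ?F)"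
    by (intro fps_ext, case_tac n) (simp_all add: peak_dyck_fps_def)
  then show ?thesis
    by (simp add: algebra_simps)
qed

lemma peak_dyck_fps_nth_0 [simp]: "fps_nth (peak_dyck_fps P) 0 = 1"
  by (simp add: peak_dyck_fps_def)

section \<open>Hankel determinants and continued fractions\<close>

text \<open>A bivariate series in \<open>x\<close> and \<open>y\<close> is a series in \<open>x\<close> whose coefficients are series in \<open>y\<close>:
  \<open>fps_outer F\<close> is \<open>F(x)\<close> and \<open>fps_const F\<close> is \<open>F(y)\<close>.\<close>

definition fps_outer :: "'a::comm_ring_1 fps \<Rightarrow> 'a fps fps" where
  "fps_outer F = Abs_fps (\<lambda>i. fps_const (fps_nth F i))"

definition fps_matrix :: "(nat \<Rightarrow> nat \<Rightarrow> 'a::comm_ring_1) \<Rightarrow> 'a fps fps" where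
  "fps_matrix M = Abs_fps (\<lambda>i. Abs_fps (M i))"

lemma fps_matrix_nth [simp]: "fps_nth (fps_nth (fps_matrix M) i) j = M i j"
  by (simp add: fps_matrix_def)

lemma fps_outer_nth [simp]: "fps_nth (fps_outer F) i = fps_const (fps_nth F i)"
  by (simp add: fps_outer_def)

lemma fps_const_sum: "fps_const (sum f A) = (\<Sum>x\<in>A. fps_const (f x :: 'a::comm_ring_1))"
  by (induction A rule: infinite_finite_induct) (simp_all flip: fps_const_add)

lemma fps_outer_mult: "fps_outer (F * G) = fps_outer F * fps_outer G"
  by (rule fps_ext) (simp add: fps_mult_nth fps_const_sum flip: fps_const_mult)

lemma fps_outer_add: "fps_outer (F + G) = fps_outer F + fps_outer G"
  by (rule fps_ext) (simp flip: fps_const_add)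

lemma fps_outer_diff: "fps_outer (F - G) = fps_outer F - fps_outer G"
  by (rule fps_ext) (simp flip: fps_const_sub)

lemma fps_outer_const: "fps_outer (fps_const c) = fps_const (fps_const c)"
  by (rule fps_ext) simp

lemma fps_outer_X: "fps_outer fps_X = fps_X"
  by (rule fps_ext) (simp add: fps_X_def)

lemma fps_outer_1: "fps_outer 1 = 1"
  by (rule fps_ext) simp

lemmas fps_outer_simps = fps_outer_mult fps_outer_add fps_outer_diff fps_outer_const fps_outer_X fps_outer_1

abbreviation fps_Y :: "'a::comm_ring_1 fps fps" where
  "fps_Y \<equiv> fps_const fps_X"

lemma fps_X_neq_Y: "fps_X - fps_Y \<noteq> (0 :: 'a::comm_ring_1 fps fps)"
proof
  assume "fps_X - fps_Y = (0 :: 'a fps fps)"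
  then have "fps_nth (fps_X - fps_Y :: 'a fps fps) 1 = 0"
    by simp
  then show False by simp
qed

text \<open>The entries depend on \<open>i + j\<close> only, so multiplication by
  \<open>x - y\<close> telescopes and leaves the two boundary terms.\<close>

lemma fps_matrix_hankel:
  "(fps_X - fps_Y) * fps_matrix (\<lambda>i j. fps_nth F (i + j)) =
     fps_X * fps_outer F - fps_Y * fps_const F"
proof (intro fps_ext)
  fix i j
  show "fps_nth (fps_nth ((fps_X - fps_Y) * fps_matrix (\<lambda>i j. fps_nth F (i + j))) i) j =
    fps_nth (fps_nth (fps_X * fps_outer F - fps_Y * fps_const F) i) j"
    by (cases i; cases j) (simp_all add: left_diff_distrib)
qed

lemma det_fps_matrix_congruence:
  fixes M N :: "nat \<Rightarrow> nat \<Rightarrow> 'a::comm_ring_1"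
  assumes "fps_matrix M = fps_outer T * fps_const T * fps_matrix N" "fps_nth T 0 = 1"
  shows "det (mat n n (\<lambda>(i, j). M i j)) = det (mat n n (\<lambda>(i, j). N i j))"
proof -
  \<comment> \<open>The lower triangular Toeplitz matrix of \<open>T\<close>: the factor
    \<open>T(x)\<close> acts as \<open>L\<close> on the left, \<open>T(y)\<close> as its transpose
    on the right.\<close>
  define L where "L = mat n n (\<lambda>(i, p). if p \<le> i then fps_nth T (i - p) else 0)"
  let ?N = "mat n n (\<lambda>(i, j). N i j)"
  have conv: "(\<Sum>p = 0..<n. (if p \<le> i then fps_nth T (i - p) else 0) * f p) =
      (\<Sum>p = 0..i. fps_nth T p * f (i - p))" if "i < n" for i and f :: "nat \<Rightarrow> 'a"
  proof -
    have "(\<Sum>p = 0..<n. (if p \<le> i then fps_nth T (i - p) else 0) * f p) =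
        (\<Sum>p = 0..i. fps_nth T (i - p) * f p)"
      by (rule sum.mono_neutral_cong_right) (use that in auto)
    also have "\<dots> = (\<Sum>p = 0..i. fps_nth T p * f (i - p))"
      by (rule sum.reindex_bij_witness[of _ "\<lambda>p. i - p" "\<lambda>p. i - p"]) auto
    finally show ?thesis .
  qed
  have "M i j = (\<Sum>p = 0..i. fps_nth T p * (\<Sum>q = 0..j. fps_nth T q * N (i - p) (j - q)))" for i j
  proof -
    have "M i j = fps_nth (fps_nth (fps_outer T * (fps_const T * fps_matrix N)) i) j"
      using assms(1) by (metis fps_matrix_nth mult.assoc)
    then show ?thesis
      by (simp add: fps_mult_nth[of "fps_outer T"] fps_mult_nth[of T] fps_sum_nth)
  qed
  then have "mat n n (\<lambda>(i, j). M i j) = L * (?N * transpose_mat L)"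
    by (intro eq_matI) (simp_all add: L_def scalar_prod_def conv mult.commute[of "N _ _"])
  moreover have "det L = 1"
  proof -
    have "det L = prod_list (diag_mat L)"
      by (rule det_lower_triangular[of n]) (auto simp: L_def)
    then show ?thesis
      using assms(2) by (simp add: prod_list_diag_prod L_def)
  qed
  moreover have L: "L \<in> carrier_mat n n" and N: "?N \<in> carrier_mat n n"
    by (simp_all add: L_def)
  moreover have "det (L * (?N * transpose_mat L)) = det L * (det ?N * det L)"
    by (simp only: det_mult[OF L mult_carrier_mat[OF N]] det_mult[OF N] det_transpose[OF L]
        transpose_carrier_mat L)
  ultimately show ?thesis
    by simp
qed

lemma mat_delete_0_0:
  "mat_delete (mat (Suc n) (Suc n) f) 0 0 = mat n n (\<lambda>(i, j). f (Suc i, Suc j))"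
  by (rule eq_matI) (auto simp: mat_delete_def)

lemma det_first_column:
  assumes "\<And>i. 0 < i \<Longrightarrow> i \<le> n \<Longrightarrow> f (i, 0) = 0"
  shows "det (mat (Suc n) (Suc n) f) = f (0, 0) * det (mat n n (\<lambda>(i, j). f (Suc i, Suc j)))"
proof -
  let ?A = "mat (Suc n) (Suc n) f"
  have "det ?A = (\<Sum>i<Suc n. ?A $$ (i, 0) * cofactor ?A i 0)"
    by (rule laplace_expansion_column) auto
  also have "\<dots> = (\<Sum>i\<in>{0}. ?A $$ (i, 0) * cofactor ?A i 0)"
    by (rule sum.mono_neutral_right) (use assms in auto)
  finally show ?thesis
    by (simp add: cofactor_def mat_delete_0_0)
qed

text \<open>By \<open>fps_matrix_hankel\<close> the Hankel matrix of \<open>F\<close> has the generating function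
  \<open>(x F(x) - y F(y)) / (x - y)\<close>, and a factor \<open>T(x) T(y)\<close> is a congruence by a unitriangular
  matrix.\<close>

lemma hankel_det_eqI:
  fixes F :: "'a::idom fps"
  assumes "fps_X * fps_outer F - fps_Y * fps_const F =
      fps_outer T * fps_const T * ((fps_X - fps_Y) * fps_matrix N)"
    and "fps_nth T 0 = 1"
  shows "hankel_det F n = det (mat n n (\<lambda>(i, j). N i j))"
proof -
  have "(fps_X - fps_Y) * fps_matrix (\<lambda>i j. fps_nth F (i + j)) =
      (fps_X - fps_Y) * (fps_outer T * fps_const T * fps_matrix N)"
    unfolding fps_matrix_hankel assms(1) by (simp only: ac_simps)
  then have "fps_matrix (\<lambda>i j. fps_nth F (i + j)) = fps_outer T * fps_const T * fps_matrix N"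
    using fps_X_neq_Y[where ?'a='a] by (simp only: mult_cancel_left) blast
  from det_fps_matrix_congruence[OF this assms(2)] show ?thesis
    by (simp add: hankel_det_def)
qed

text \<open>With \<open>T = 1 + x K = 1 / (1 - x C)\<close> one gets
  \<open>x K(x) - y K(y) = T(x) T(y) (x C(x) - y C(y))\<close>, a congruence of the two Hankel
  matrices.\<close>

lemma hankel_det_invariant:
  fixes K C :: "'a::idom fps"
  assumes "K * (1 - fps_X * C) = C"
  shows "hankel_det K n = hankel_det C n"
proof -
  have invariant: "x * k - y * k' = t * t' * (x * c - y * c')"
    if "x * k = x * c * t" "y * k' = y * c' * t'" "t = 1 + x * k" "t' = 1 + y * k'"
    for x y k k' c c' t t' :: "'a fps fps"
  proof -
    have "t * t' * (x * c - y * c') = t' * (x * c * t) - t * (y * c' * t')"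
      by (simp add: algebra_simps)
    also have "\<dots> = t' * (x * k) - t * (y * k')"
      by (simp only: that(1,2))
    also have "\<dots> = x * k - y * k'"
      unfolding that(3,4) by (simp add: algebra_simps)
    finally show ?thesis ..
  qed
  define T where "T = 1 + fps_X * K"
  have eq: "fps_X * K = fps_X * C * T"
    using arg_cong[OF assms, of "\<lambda>H. fps_X * H"] by (simp add: T_def algebra_simps)
  have x: "fps_X * fps_outer K = fps_X * fps_outer C * fps_outer T"
    using arg_cong[OF eq, of fps_outer] by (simp only: fps_outer_simps)
  have y: "fps_Y * fps_const K = fps_Y * fps_const C * fps_const T"
    using arg_cong[OF eq, of fps_const] by (simp only: fps_const_mult)
  have Tx: "fps_outer T = 1 + fps_X * fps_outer K" and Ty: "fps_const T = 1 + fps_Y * fps_const K"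
    by (simp_all add: T_def fps_outer_simps flip: fps_const_add)
  have "fps_X * fps_outer K - fps_Y * fps_const K =
      fps_outer T * fps_const T * (fps_X * fps_outer C - fps_Y * fps_const C)"
    using x y Tx Ty by (rule invariant)
  then show ?thesis
    by (subst hankel_det_eqI[where T = T and N = "\<lambda>i j. fps_nth C (i + j)"])
      (simp_all add: fps_matrix_hankel T_def hankel_det_def)
qed

text \<open>Once \<open>F(x) F(y)\<close> is factored out, the matrix left is the block sum of the 1
  by 1 identity and the Hankel matrix of \<open>G\<close>.\<close>

lemma hankel_det_J_fraction:
  fixes F G :: "'a::idom fps"
  assumes "F * (1 - fps_const a * fps_X - fps_X ^ 2 * G) = 1"
  shows "hankel_det F (Suc n) = hankel_det G n"
proof -
  have J_fraction: "x * f - y * f' = f * f' * ((x - y) * (1 + x * (y * h)))"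
    if "f * (1 - c * x - x ^ 2 * g) = 1" "f' * (1 - c * y - y ^ 2 * g') = 1" "(x - y) * h = x * g - y * g'"
    for x y f f' g g' c h :: "'a fps fps"
  proof -
    have "x * f - y * f' = x * f * (f' * (1 - c * y - y ^ 2 * g')) - y * f' * (f * (1 - c * x - x ^ 2 * g))"
      using that by simp
    also have "\<dots> = f * f' * ((x - y) + x * (y * (x * g - y * g')))"
      by (simp add: algebra_simps power2_eq_square)
    also have "\<dots> = f * f' * ((x - y) * (1 + x * (y * h)))"
      unfolding that(3)[symmetric] by (simp add: algebra_simps)
    finally show ?thesis .
  qed
  define N where "N i j = (if i = 0 \<and> j = 0 then 1 else if i = 0 \<or> j = 0 then 0
    else fps_nth G (i - 1 + (j - 1)))" for i j
  let ?H = "fps_matrix (\<lambda>i j. fps_nth G (i + j))"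
  have N: "fps_matrix N = 1 + fps_X * (fps_Y * ?H)"
  proof (intro fps_ext)
    fix i j
    show "fps_nth (fps_nth (fps_matrix N) i) j = fps_nth (fps_nth (1 + fps_X * (fps_Y * ?H)) i) j"
      by (cases i; cases j) (simp_all add: N_def)
  qed
  have F0: "fps_nth F 0 = 1"
    using arg_cong[OF assms, of "\<lambda>H. fps_nth H 0"] by (simp add: power2_eq_square mult.assoc)
  have x: "fps_outer F * (1 - fps_const (fps_const a) * fps_X - fps_X ^ 2 * fps_outer G) = 1"
    using arg_cong[OF assms, of fps_outer] by (simp only: fps_outer_simps power2_eq_square)
  have y: "fps_const F * (1 - fps_const (fps_const a) * fps_Y - fps_Y ^ 2 * fps_const G) = 1"
    using arg_cong[OF assms, of fps_const]
    by (simp only: power2_eq_square fps_const_1_eq_1 flip: fps_const_mult fps_const_sub)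
  have "fps_X * fps_outer F - fps_Y * fps_const F =
      fps_outer F * fps_const F * ((fps_X - fps_Y) * fps_matrix N)"
    unfolding N using x y fps_matrix_hankel[of G] by (rule J_fraction)
  from hankel_det_eqI[OF this F0] have "hankel_det F (Suc n) = det (mat (Suc n) (Suc n) (\<lambda>(i, j). N i j))" .
  also have "\<dots> = hankel_det G n"
    by (subst det_first_column) (auto simp: N_def hankel_det_def)
  finally show ?thesis .
qed

text \<open>The extra \<open>x\<close> makes the leading block 2 by 2 with rows (0, 1) and (1, -a),
  of determinant -1. Behind it stands the Hankel matrix of \<open>fps_shift 1 G\<close>, since the
  constant term cancels in \<open>G(x) - G(y)\<close>.\<close>

lemma hankel_det_X_mult:
  fixes F G :: "'a::idom fps"
  assumes "F * (1 - fps_const a * fps_X - fps_X ^ 2 * G) = 1"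
  shows "hankel_det (fps_X * F) (Suc (Suc n)) = - hankel_det (fps_shift 1 G) n"
proof -
  have J_fraction: "x * (x * f) - y * (y * f') =
      f * f' * ((x - y) * (x + y - x * (y * c) + x * (x * (y * (y * h)))))"
    if "f * (1 - c * x - x ^ 2 * g) = 1" "f' * (1 - c * y - y ^ 2 * g') = 1" "(x - y) * h = x * k - y * k'"
      "x * k = g - d" "y * k' = g' - d"
    for x y f f' g g' c d h k k' :: "'a fps fps"
  proof -
    have h: "g - g' = (x - y) * h"
      using that(3-5) by simp
    have "x * (x * f) - y * (y * f') =
        x * (x * f) * (f' * (1 - c * y - y ^ 2 * g')) - y * (y * f') * (f * (1 - c * x - x ^ 2 * g))"
      using that by simp
    also have "\<dots> = f * f' * ((x - y) * (x + y - x * (y * c)) + x * (x * (y * (y * (g - g')))))"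
      by (simp add: algebra_simps power2_eq_square)
    also have "\<dots> = f * f' * ((x - y) * (x + y - x * (y * c) + x * (x * (y * (y * h)))))"
      unfolding h by (simp add: algebra_simps)
    finally show ?thesis .
  qed
  define N where "N i j = (if i = 0 then (if j = 1 then 1 else 0)
    else if i = 1 then (if j = 0 then 1 else if j = 1 then - a else 0)
    else if j = 0 \<or> j = 1 then 0 else fps_nth G (i - 2 + (j - 2) + 1))" for i j
  let ?H = "fps_matrix (\<lambda>i j. fps_nth (fps_shift 1 G) (i + j))"
  have N: "fps_matrix N = fps_X + fps_Y - fps_X * (fps_Y * fps_const (fps_const a))
      + fps_X * (fps_X * (fps_Y * (fps_Y * ?H)))" (is "_ = ?R")
  proof (intro fps_ext)
    fix i j
    show "fps_nth (fps_nth (fps_matrix N) i) j = fps_nth (fps_nth ?R i) j"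
      by (cases i; cases "i - 1"; cases j; cases "j - 1") (simp_all add: N_def)
  qed
  have F0: "fps_nth F 0 = 1"
    using arg_cong[OF assms, of "\<lambda>H. fps_nth H 0"] by (simp add: power2_eq_square mult.assoc)
  have x: "fps_outer F * (1 - fps_const (fps_const a) * fps_X - fps_X ^ 2 * fps_outer G) = 1"
    using arg_cong[OF assms, of fps_outer] by (simp only: fps_outer_simps power2_eq_square)
  have y: "fps_const F * (1 - fps_const (fps_const a) * fps_Y - fps_Y ^ 2 * fps_const G) = 1"
    using arg_cong[OF assms, of fps_const]
    by (simp only: power2_eq_square fps_const_1_eq_1 flip: fps_const_mult fps_const_sub)
  have G: "fps_X * fps_shift 1 G = G - fps_const (fps_nth G 0)"
    by (rule fps_ext) simp
  have gx: "fps_X * fps_outer (fps_shift 1 G) = fps_outer G - fps_const (fps_const (fps_nth G 0))"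
    using arg_cong[OF G, of fps_outer] by (simp only: fps_outer_simps)
  have gy: "fps_Y * fps_const (fps_shift 1 G) = fps_const G - fps_const (fps_const (fps_nth G 0))"
    using arg_cong[OF G, of fps_const] by (simp only: fps_const_mult fps_const_sub)
  have "fps_X * fps_outer (fps_X * F) - fps_Y * fps_const (fps_X * F) =
      fps_X * (fps_X * fps_outer F) - fps_Y * (fps_Y * fps_const F)"
    by (simp add: fps_outer_simps)
  also have "\<dots> = fps_outer F * fps_const F * ((fps_X - fps_Y) * fps_matrix N)"
    unfolding N using x y fps_matrix_hankel[of "fps_shift 1 G"] gx gy by (rule J_fraction)
  finally have "hankel_det (fps_X * F) (Suc (Suc n)) =
      det (mat (Suc (Suc n)) (Suc (Suc n)) (\<lambda>(i, j). N i j))" (is "_ = det ?A")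
    by (rule hankel_det_eqI) (fact F0)
  also have "det ?A = (\<Sum>i<Suc (Suc n). ?A $$ (i, 0) * cofactor ?A i 0)"
    by (rule laplace_expansion_column) auto
  also have "\<dots> = (\<Sum>i\<in>{1}. ?A $$ (i, 0) * cofactor ?A i 0)"
    by (rule sum.mono_neutral_right) (auto simp: N_def)
  also have "\<dots> = - det (mat_delete ?A 1 0)"
    by (simp add: cofactor_def N_def)
  also have "mat_delete ?A 1 0 = mat (Suc n) (Suc n) (\<lambda>(i, j). N (if i = 0 then 0 else Suc i) (Suc j))"
    by (rule eq_matI) (auto simp: mat_delete_def)
  also have "det \<dots> = hankel_det (fps_shift 1 G) n"
    by (subst det_first_column) (auto simp: N_def hankel_det_def)
  finally show ?thesis .
qed

text \<open>The constant coefficient sits only in the top left entry, so the determinant is affine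
  in it, with the complementary minor as slope.\<close>

lemma hankel_det_add_const:
  "hankel_det (fps_const c + F) (Suc n) = hankel_det F (Suc n) + c * hankel_det (fps_shift 2 F) n"
proof -
  let ?M = "\<lambda>H. mat (Suc n) (Suc n) (\<lambda>(i, j). fps_nth H (i + j))"
  have expand: "hankel_det H (Suc n) = fps_nth H 0 * hankel_det (fps_shift 2 H) n +
      (\<Sum>i<n. fps_nth H (Suc i) * cofactor (?M H) (Suc i) 0)" for H :: "'a fps"
  proof -
    have "det (?M H) = (\<Sum>i<Suc n. ?M H $$ (i, 0) * cofactor (?M H) i 0)"
      by (rule laplace_expansion_column) auto
    moreover have "cofactor (?M H) 0 0 = hankel_det (fps_shift 2 H) n"
      by (simp add: cofactor_def mat_delete_0_0 hankel_det_def numeral_2_eq_2)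
    ultimately show ?thesis
      by (simp add: hankel_det_def[of H] sum.lessThan_Suc_shift del: sum.lessThan_Suc)
  qed
  have "fps_shift 2 (fps_const c + F) = fps_shift 2 F"
    by (rule fps_ext) simp
  moreover have "mat_delete (?M (fps_const c + F)) (Suc i) 0 = mat_delete (?M F) (Suc i) 0" for i
    by (rule eq_matI) (auto simp: mat_delete_def)
  then have "cofactor (?M (fps_const c + F)) (Suc i) 0 = cofactor (?M F) (Suc i) 0" for i
    by (simp only: cofactor_def)
  then have "(\<Sum>i<n. fps_nth (fps_const c + F) (Suc i) * cofactor (?M (fps_const c + F)) (Suc i) 0) =
      (\<Sum>i<n. fps_nth F (Suc i) * cofactor (?M F) (Suc i) 0)"
    by (intro sum.cong) (simp_all only: fps_add_nth fps_nth_fps_const nat.distinct if_False add_0)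
  ultimately show ?thesis
    unfolding expand[of F] expand[of "fps_const c + F"] by (simp add: algebra_simps)
qed

text \<open>Up to a power of \<open>v\<close> this is the Hankel determinant of \<open>u + v x G\<close>. Being linear in
  \<open>(u, v)\<close>, it avoids the division in the continued fraction step \<open>c \<mapsto> a - 1 / c\<close> for \<open>c = u / v\<close>.\<close>

definition hankel_pair :: "nat \<Rightarrow> 'a::comm_ring_1 \<Rightarrow> 'a \<Rightarrow> 'a fps \<Rightarrow> 'a" where
  "hankel_pair n u v G = u * hankel_det (fps_shift 1 G) n + v * hankel_det (fps_X * G) (Suc n)"

text \<open>The link to ordinary Hankel determinants at both ends: the iteration starts from the
  pair (1, 1) and, under primitivity, reaches a pair of equal values.\<close>

lemma hankel_pair_same: "hankel_pair n u u G = u * hankel_det (1 + fps_X * G) (Suc n)"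
proof -
  have "fps_shift 2 (fps_X * G) = fps_shift 1 G"
    by (rule fps_ext) simp
  then show ?thesis
    using hankel_det_add_const[of 1 "fps_X * G" n] by (simp add: hankel_pair_def algebra_simps)
qed

text \<open>Write \<open>1 / G = 1 - x C\<close> with \<open>C = a + x G'\<close>. Then
  \<open>(G - 1) / x\<close> has the Hankel determinants of \<open>C\<close>, from which
  \<open>a\<close> splits off, and \<open>hankel_det_X_mult\<close> supplies the term with
  \<open>v\<close>.\<close>

lemma hankel_pair_step:
  fixes G G' :: "'a::idom fps"
  assumes "G * (1 - fps_const a * fps_X - fps_X ^ 2 * G') = 1"
  shows "hankel_pair (Suc n) u v G = hankel_pair n (a * u - v) u G'"
proof -
  define C where "C = fps_const a + fps_X * G'"
  have G: "G * (1 - fps_X * C) = 1"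
    using assms by (simp add: C_def algebra_simps power2_eq_square)
  have "fps_nth G 0 = 1"
    using arg_cong[OF G, of "\<lambda>H. fps_nth H 0"] by simp
  then have shift: "G = 1 + fps_X * fps_shift 1 G"
    by (intro fps_ext) simp
  have "fps_X * (fps_shift 1 G * (1 - fps_X * C)) = fps_X * C"
    using G by (subst (asm) shift) (simp add: algebra_simps)
  then have "fps_shift 1 G * (1 - fps_X * C) = C"
    by simp
  then have "hankel_det (fps_shift 1 G) (Suc n) = hankel_det C (Suc n)"
    by (rule hankel_det_invariant)
  also have "\<dots> = hankel_det (fps_X * G') (Suc n) + a * hankel_det (fps_shift 1 G') n"
  proof -
    have "fps_shift 2 (fps_X * G') = fps_shift 1 G'"
      by (rule fps_ext) simp
    then show ?thesis
      by (simp add: C_def hankel_det_add_const)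
  qed
  finally show ?thesis
    using hankel_det_X_mult[OF assms, of n] by (simp add: hankel_pair_def algebra_simps)
qed

text \<open>The coefficient \<open>c\<close> only changes the linear term of a J-fraction, which
  leaves the determinant alone. So a forbidden odd height is harmless when the even height after it
  is allowed.\<close>

lemma hankel_det_two_steps:
  fixes F F' K :: "'a::idom fps"
  assumes "F * (1 + fps_const c * fps_X - fps_X * F') = 1" "F' * (1 - fps_X * K) = 1"
  shows "hankel_det F (Suc n) = hankel_det K n"
proof -
  have "F * (1 - fps_const (1 - c) * fps_X - fps_X ^ 2 * (K * F')) = 1"
  proof -
    have "F' = 1 + fps_X * K * F'"
      using assms(2) by (simp add: algebra_simps)
    with assms(1) have "F * (1 + fps_const c * fps_X - fps_X * (1 + fps_X * K * F')) = 1"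
      by simp
    then show ?thesis
      by (simp add: algebra_simps power2_eq_square flip: fps_const_sub)
  qed
  then have "hankel_det F (Suc n) = hankel_det (K * F') n"
    by (rule hankel_det_J_fraction)
  also have "\<dots> = hankel_det K n"
    by (rule hankel_det_invariant) (use assms(2) in \<open>simp add: mult.assoc\<close>)
  finally show ?thesis .
qed

text \<open>\<open>hankel_rec\<close> also has its index shifted: \<open>hankel_rec e (Suc k)\<close> is \<open>P\<^sub>k\<close>.\<close>

fun hankel_rec :: "(nat \<Rightarrow> 'a::comm_ring_1) \<Rightarrow> nat \<Rightarrow> 'a" where
  "hankel_rec e 0 = 1"
| "hankel_rec e (Suc 0) = 1"
| "hankel_rec e (Suc (Suc k)) = (2 - e (Suc k)) * hankel_rec e (Suc k) - hankel_rec e k"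

text \<open>Climbing two levels trades one unit of the determinant index for one step of
  \<open>hankel_rec\<close>, so the induction hypothesis is used at \<open>Suc n\<close>.\<close>

lemma hankel_pair_iterate:
  fixes F :: "nat \<Rightarrow> 'a::idom fps"
  assumes step: "\<And>k. F k * (1 + fps_const (e (Suc k)) * fps_X - fps_X * F (Suc k)) = 1"
    and odd: "\<And>k. k < k0 \<Longrightarrow> e (Suc (2 * k)) = 0"
  shows "k \<le> k0 \<Longrightarrow> hankel_det (F 0) (Suc (n + k)) =
    hankel_pair n (hankel_rec (\<lambda>k. e (2 * k)) (Suc k)) (hankel_rec (\<lambda>k. e (2 * k)) k) (fps_shift 1 (F (2 * k)))"
proof (induction k arbitrary: n)
  have nth_0: "fps_nth (F k) 0 = 1" for k
    using arg_cong[OF step[of k], of "\<lambda>H. fps_nth H 0"] by simp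
  then have shift: "F k = 1 + fps_X * fps_shift 1 (F k)" for k
    by (intro fps_ext) simp
  {
    case 0
    then show ?case
      using hankel_pair_same[of n 1 "fps_shift 1 (F 0)"] shift[of 0] by simp
  next
    case (Suc k)
    let ?F = "F (2 * k)" and ?F1 = "F (Suc (2 * k))" and ?F2 = "F (2 * Suc k)"
    let ?a = "2 - e (2 * Suc k)"
    have F: "?F * (1 - fps_X * ?F1) = 1"
      using step[of "2 * k"] odd[of k] Suc.prems by simp
    have F1: "?F1 * (1 + fps_const (e (2 * Suc k)) * fps_X - fps_X * (1 + fps_X * fps_shift 1 ?F2)) = 1"
      using step[of "Suc (2 * k)"] shift[of "2 * Suc k"] by simp
    have "?F = 1 + fps_X * (?F * ?F1)"
      using F by (simp add: algebra_simps)
    then have "1 + fps_X * fps_shift 1 ?F = 1 + fps_X * (?F * ?F1)"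
      using shift[of "2 * k"] by metis
    then have "fps_shift 1 ?F = ?F * ?F1"
      by simp
    \<comment> \<open>Here \<open>1 / (?F * ?F1) = 1 / ?F1 - x\<close>, and \<open>1 / ?F1\<close>
      contributes another \<open>- x\<close> from the constant term of \<open>?F2\<close>; together
      they make the 2 in \<open>?a\<close>.\<close>
    moreover have "?F * ?F1 * (1 - fps_const ?a * fps_X - fps_X ^ 2 * fps_shift 1 ?F2) = 1"
    proof -
      have "f * f1 * (1 - (2 - c) * x - x ^ 2 * g) = 1"
        if "f * (1 - x * f1) = 1" "f1 * (1 + c * x - x * (1 + x * g)) = 1" for f f1 c x g :: "'a fps"
      proof -
        have "f1 * (1 - (2 - c) * x - x ^ 2 * g) = f1 * (1 + c * x - x * (1 + x * g)) - x * f1"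
          by (simp add: algebra_simps power2_eq_square)
        then show ?thesis
          using that by (simp add: mult.assoc)
      qed
      from this[OF F F1] show ?thesis
        by (simp flip: fps_const_sub add: numeral_fps_const)
    qed
    ultimately have "fps_shift 1 ?F * (1 - fps_const ?a * fps_X - fps_X ^ 2 * fps_shift 1 ?F2) = 1"
      by simp
    from hankel_pair_step[OF this] Suc.IH[of "Suc n"] Suc.prems show ?case
      by simp
  }
qed

lemma hankel_det_quasi_period:
  fixes F :: "nat \<Rightarrow> 'a::idom fps"
  assumes step: "\<And>k. F k * (1 + fps_const (e (Suc k)) * fps_X - fps_X * F (Suc k)) = 1"
    and odd: "\<And>k. k < k0 \<Longrightarrow> e (Suc (2 * k)) = 0"
    and even: "\<And>k. k0 < k \<Longrightarrow> k \<le> p \<Longrightarrow> e (2 * k) = 0"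
    and rec: "hankel_rec (\<lambda>k. e (2 * k)) k0 = c" "hankel_rec (\<lambda>k. e (2 * k)) (Suc k0) = c"
    and "k0 \<le> p"
  shows "hankel_det (F 0) (Suc (n + p)) = c * hankel_det (F (2 * p)) (Suc n)"
proof -
  have tail: "hankel_det (F (2 * k0)) (n + j) = hankel_det (F (2 * (k0 + j))) n" if "k0 + j \<le> p" for j n
    using that
  proof (induction j arbitrary: n)
    case (Suc j)
    let ?k = "k0 + j"
    have "hankel_det (F (2 * ?k)) (Suc n) = hankel_det (F (2 * Suc ?k)) n"
      by (rule hankel_det_two_steps) (use step[of "2 * ?k"] step[of "Suc (2 * ?k)"] even[of "Suc ?k"] Suc.prems in auto)
    then show ?case
      using Suc.IH[of "Suc n"] Suc.prems by simp
  qed simp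
  have "fps_nth (F (2 * k0)) 0 = 1"
    using arg_cong[OF step[of "2 * k0"], of "\<lambda>H. fps_nth H 0"] by simp
  then have shift: "F (2 * k0) = 1 + fps_X * fps_shift 1 (F (2 * k0))"
    by (intro fps_ext) simp
  have "hankel_det (F 0) (Suc (n + p)) = hankel_det (F 0) (Suc ((n + (p - k0)) + k0))"
    using \<open>k0 \<le> p\<close> by simp
  also have "\<dots> = c * hankel_det (F (2 * k0)) (Suc (n + (p - k0)))"
    using hankel_pair_iterate[where F = F and e = e, OF step odd order_refl, of k0] rec shift
    by (simp add: hankel_pair_same)
  also have "\<dots> = c * hankel_det (F (2 * p)) (Suc n)"
    using tail[of "p - k0" "Suc n"] \<open>k0 \<le> p\<close> by simp
  finally show ?thesis .
qed

section \<open>Primitive sequences\<close>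

text \<open>The index is shifted by one: \<open>prim_cont t (Suc j)\<close> is \<open>P\<^sub>k - P\<^sub>k\<^sub>-\<^sub>1\<close> at
  \<open>k = s + t\<^sub>1 + \<dots> + t\<^sub>j\<close>, so it starts with \<open>P\<^sub>s - P\<^sub>s\<^sub>-\<^sub>1 = -1\<close>.\<close>

fun prim_cont :: "(nat \<Rightarrow> nat) \<Rightarrow> nat \<Rightarrow> int" where
  "prim_cont t 0 = 0"
| "prim_cont t (Suc 0) = - 1"
| "prim_cont t (Suc (Suc j)) = (2 - int (t (Suc j))) * prim_cont t (Suc j) - prim_cont t j"

text \<open>The older term enters the recurrence with coefficient -1, so common divisors pass down.
  Hence a value followed by 0 is a unit.\<close>

lemma coprime_prim_cont: "coprime (prim_cont t j) (prim_cont t (Suc j))"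
proof (induction j)
  case (Suc j)
  show ?case
  proof (rule coprimeI)
    fix x
    assume x: "x dvd prim_cont t (Suc j)" "x dvd prim_cont t (Suc (Suc j))"
    have "prim_cont t j = (2 - int (t (Suc j))) * prim_cont t (Suc j) - prim_cont t (Suc (Suc j))"
      by simp
    also have "x dvd \<dots>"
      using x by (intro dvd_diff dvd_mult)
    finally show "is_unit x"
      using x(1) Suc coprime_common_divisor by blast
  qed
qed simp

text \<open>Consecutive values have ratio \<open>seq_h t j\<close>. Only earlier
  \<open>seq_h\<close> are divided by, so the one at \<open>b\<close> may vanish, as it does for a
  primitive sequence.\<close>

lemma prim_cont_eq_prod:
  assumes "\<And>j. j \<in> {1..<b} \<Longrightarrow> seq_h t j \<noteq> 0"
  shows "j \<le> b \<Longrightarrow> of_int (prim_cont t (Suc j)) = - (\<Prod>i=1..j. seq_h t i)"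
proof (induction j rule: less_induct)
  case (less j)
  consider "j = 0" | "j = 1" | i where "j = Suc (Suc i)"
    by (metis One_nat_def not0_implies_Suc)
  then show ?case
  proof cases
    case 3
    \<comment> \<open>The upper limit is the \<open>i\<close> obtained above; the product variable
      shadows it only in the factor.\<close>
    let ?A = "\<Prod>i=1..i. seq_h t i"
    have nz: "seq_h t (Suc i) \<noteq> 0"
      using assms[of "Suc i"] less.prems 3 by simp
    have "of_int (prim_cont t (Suc j)) =
        (2 - of_nat (t (Suc (Suc i)))) * of_int (prim_cont t (Suc (Suc i))) - (of_int (prim_cont t (Suc i)) :: rat)"
      using 3 by simp
    also have "\<dots> = (2 - of_nat (t (Suc (Suc i)))) * (- (?A * seq_h t (Suc i))) - (- ?A)"
      using less.IH[of i] less.IH[of "Suc i"] less.prems 3 by (simp del: prim_cont.simps seq_h.simps)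
    also have "\<dots> = - (?A * seq_h t (Suc i) * seq_h t j)"
      using nz 3 by (simp add: field_simps del: seq_h.simps(2))
    finally show ?thesis
      using 3 by (simp del: prim_cont.simps seq_h.simps)
  qed simp_all
qed

text \<open>Where \<open>d\<close> is 0 the recurrence continues an arithmetic progression; where
  \<open>d\<close> is 1 the new value is the preceding difference. A gap of length \<open>t\<close>
  thus sends the differences \<open>q'\<close>, \<open>q\<close> to \<open>q\<close>,
  \<open>(2 - t) q - q'\<close>.\<close>

lemma hankel_rec_prim_cont:
  assumes "s > 0" "\<And>j. j \<in> {1..b} \<Longrightarrow> t j > 0"
    and d1: "\<And>j. j \<le> b \<Longrightarrow> d (s + (\<Sum>i=1..j. t i)) = 1"
    and d0: "\<And>k. 0 < k \<Longrightarrow> k \<le> s + (\<Sum>i=1..b. t i) \<Longrightarrow> k \<notin> {s + (\<Sum>i=1..j. t i) | j. j \<le> b} \<Longrightarrow> d k = 0"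
  shows "j \<le> b \<Longrightarrow> hankel_rec d (Suc (s + (\<Sum>i=1..j. t i))) = prim_cont t j \<and>
    hankel_rec d (s + (\<Sum>i=1..j. t i)) = prim_cont t j - prim_cont t (Suc j)"
proof -
  define T where "T j = s + (\<Sum>i=1..j. t i)" for j
  have T_Suc: "T (Suc j) = T j + t (Suc j)" for j
    by (simp add: T_def)
  have T_mono: "T i \<le> T j" if "i \<le> j" for i j
    unfolding T_def using that by (intro add_left_mono sum_mono2) auto
  have between: "d k = 0" if "T j < k" "k < T (Suc j)" "Suc j \<le> b" for j k
  proof (rule d0)
    show "k \<le> s + (\<Sum>i=1..b. t i)"
      using that T_mono[of "Suc j" b] by (simp add: T_def)
    show "k \<notin> {s + (\<Sum>i=1..j. t i) | j. j \<le> b}"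
    proof
      assume "k \<in> {s + (\<Sum>i=1..j. t i) | j. j \<le> b}"
      then obtain i where "k = T i"
        by (auto simp: T_def)
      then show False
        using that T_mono[of i j] T_mono[of "Suc j" i] by (cases "i \<le> j") auto
    qed
  qed (use that in simp)
  have before: "d k = 0" if "0 < k" "k < s" for k
  proof (rule d0)
    show "k \<le> s + (\<Sum>i=1..b. t i)"
      using that by simp
    show "k \<notin> {s + (\<Sum>i=1..j. t i) | j. j \<le> b}"
      using that by auto
  qed (use that in simp)
  have "hankel_rec d (Suc (T j)) = prim_cont t j \<and> hankel_rec d (T j) = prim_cont t j - prim_cont t (Suc j)"
    if "j \<le> b" for j
    using that
  proof (induction j)
    case 0
    \<comment> \<open>Before the first forbidden height the progression is constant.\<close>
    have initial: "hankel_rec d k = 1 \<and> hankel_rec d (Suc k) = 1" if "k < s" for k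
      using that
    proof (induction k)
      case (Suc k)
      then show ?case using before[of "Suc k"] by simp
    qed simp
    obtain k where k: "s = Suc k"
      using \<open>s > 0\<close> by (cases s) auto
    then show ?case
      using initial[of k] d1[of 0] by (simp add: T_def)
  next
    case (Suc j)
    let ?q = "prim_cont t"
    \<comment> \<open>The progression with difference \<open>?q (Suc j)\<close>, followed up to just
      before the next forbidden height.\<close>
    have run: "hankel_rec d (Suc (T j + i)) = ?q j + int i * ?q (Suc j) \<and>
        hankel_rec d (T j + i) = ?q j + (int i - 1) * ?q (Suc j)" if "i < t (Suc j)" for i
      using that
    proof (induction i)
      case 0
      then show ?case using Suc.IH Suc.prems by simp
    next
      case (Suc i)
      then show ?case
        using between[of j "Suc (T j + i)"] T_Suc[of j] \<open>Suc j \<le> b\<close> by (simp add: algebra_simps)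
    qed
    have "t (Suc j) > 0"
      using assms(2)[of "Suc j"] Suc.prems by simp
    then obtain i where i: "t (Suc j) = Suc i"
      by (cases "t (Suc j)") auto
    have "d (T (Suc j)) = 1"
      using d1[of "Suc j"] Suc.prems by (simp only: T_def)
    then have "d (Suc (T j + i)) = 1"
      using T_Suc[of j] i by simp
    then show ?case
      using run[of i] i T_Suc[of j] by (simp add: algebra_simps)
  qed
  then show "j \<le> b \<Longrightarrow> hankel_rec d (Suc (s + (\<Sum>i=1..j. t i))) = prim_cont t j \<and>
    hankel_rec d (s + (\<Sum>i=1..j. t i)) = prim_cont t j - prim_cont t (Suc j)"
    by (simp add: T_def)
qed

section \<open>Forbidden heights modulo \<open>m\<close> and the sign of the quasi-period\<close>

definition allowed_height :: "nat \<Rightarrow> nat set \<Rightarrow> int \<Rightarrow> bool" where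
  "allowed_height m V h \<longleftrightarrow> \<not> (\<exists>v\<in>V. [h = int v] (mod int m))"

text \<open>Peaks have height at least 1, so the positivity in \<open>residue_set\<close> is
  automatic.\<close>

lemma restricted_dyck_fps_eq: "restricted_dyck_fps m V = peak_dyck_fps (allowed_height m V)"
proof -
  have *: "h \<notin> int ` residue_set m V \<longleftrightarrow> allowed_height m V h" if "h \<ge> 1" for h
  proof -
    have "h = int (nat h)" "nat h > 0"
      using that by simp_all
    then obtain k where "h = int k" "k > 0"
      by blast
    then show ?thesis
      by (auto simp: residue_set_def allowed_height_def cong_int_iff image_iff)
  qed
  have "peak_heights w \<inter> int ` residue_set m V = {} \<longleftrightarrow> (\<forall>h\<in>peak_heights w. allowed_height m V h)"
    if "w \<in> dyck_paths n" for w n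
  proof -
    have "h \<ge> 1" if "h \<in> peak_heights w" for h
      using that peak_heights_pos[of w h] \<open>w \<in> dyck_paths n\<close> by (simp add: dyck_paths_eq)
    then show ?thesis
      using * by (simp add: disjoint_iff Ball_def)
  qed
  then have "{w \<in> dyck_paths n. peak_heights w \<inter> int ` residue_set m V = {}} = peak_dyck (allowed_height m V) n" for n
    unfolding peak_dyck_def by (intro Collect_cong conj_cong refl)
  then show ?thesis
    by (simp add: restricted_dyck_fps_def restricted_dyck_count_def peak_dyck_fps_def)
qed

text \<open>Turns congruence of even heights modulo \<open>m\<close> into congruence of their halves
  modulo \<open>p\<close>, for either parity of \<open>m\<close>.\<close>

lemma dvd_double_imp_dvd_period:
  fixes m p :: nat and x :: int
  assumes "p = (if even m then m div 2 else m)" "int m dvd 2 * x"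
  shows "int p dvd x"
proof (cases "even m")
  case True
  then have "int m = 2 * int p"
    using assms(1) by auto
  then show ?thesis using assms(2) by simp
next
  case False
  then have "coprime (int m) 2"
    by simp
  then show ?thesis
    using assms False by (simp add: coprime_dvd_mult_right_iff)
qed

lemma eq_if_dvd_diff:
  fixes a b c :: int
  assumes "c dvd a - b" "0 < a" "0 < b" "a \<le> c" "b \<le> c"
  shows "a = b"
proof (rule ccontr)
  assume "a \<noteq> b"
  then have "\<bar>c\<bar> \<le> \<bar>a - b\<bar>"
    using assms(1) by (intro dvd_imp_le_int) auto
  then show False
    using assms by linarith
qed

theorem theorem1p4:
  fixes l s m p :: nat and t :: "nat \<Rightarrow> nat" and V :: "nat set"
  assumes "l \<ge> 2"
    and "\<And>j. j \<in> {1..l - 1} \<Longrightarrow> t j > 0"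
    and "s > 0"
    and "V = {2 * (s + (\<Sum>i=1..j. t i)) | j. j \<le> l - 1}"
    and "m \<ge> Max V"
    and "p = (if even m then m div 2 else m)"
    and "primitive_seq t (l - 1)"
  shows "(has_period p (hankel_det (restricted_dyck_fps m V)) \<or>
          has_period (2 * p) (hankel_det (restricted_dyck_fps m V))) \<and>
         ((\<Prod>j=1..l - 2. seq_h t j) = -1 \<longrightarrow>
           has_period p (hankel_det (restricted_dyck_fps m V))) \<and>
         ((\<Prod>j=1..l - 2. seq_h t j) = 1 \<longrightarrow>
           has_period (2 * p) (hankel_det (restricted_dyck_fps m V)) \<and>
           \<not> has_period p (hankel_det (restricted_dyck_fps m V)))"
proof -
  define T where "T j = s + (\<Sum>i=1..j. t i)" for j
  define b where "b = l - 1"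
  define W where "W = T ` {..b}"
  define P where "P = allowed_height m V"
  define F where "F k = peak_dyck_fps (\<lambda>h. P (h + int k))" for k
  define e :: "nat \<Rightarrow> int" where "e k = (if P (int k) then 0 else 1)" for k
  \<comment> \<open>By \<open>rec\<close> and \<open>last\<close> below, the common value of
    \<open>hankel_rec\<close> at \<open>T b\<close> and \<open>Suc (T b)\<close>.\<close>
  define \<sigma> where "\<sigma> = prim_cont t b"
  let ?H = "hankel_det (restricted_dyck_fps m V)"
  have V: "V = (\<lambda>w. 2 * w) ` W"
    unfolding assms(4) W_def T_def b_def by (simp only: setcompr_eq_image image_image atMost_def)
  have "finite V"
    by (simp add: V W_def)
  have W: "0 < w" "2 * w \<le> m" "w \<le> p" if "w \<in> W" for w
  proof -
    show "0 < w"
      using that \<open>s > 0\<close> by (auto simp: W_def T_def)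
    have "2 * w \<le> Max V"
      using that \<open>finite V\<close> by (auto simp: V intro: Max_ge)
    then show "2 * w \<le> m"
      using assms(5) by simp
    then show "w \<le> p"
      using assms(6) by auto
  qed
  have T_W: "T b \<in> W"
    by (simp add: W_def)
  have dvd_2p: "int m dvd 2 * int p"
    using assms(6) by auto

  have step: "F k * (1 + fps_const (e (Suc k)) * fps_X - fps_X * F (Suc k)) = 1" for k
  proof -
    have "(\<lambda>h. P (h + 1 + int k)) = (\<lambda>h. P (h + int (Suc k)))"
      by (simp add: ac_simps)
    then show ?thesis
      using peak_dyck_fps_eq[of "\<lambda>h. P (h + int k)"] by (simp add: F_def e_def)
  qed
  \<comment> \<open>Such an odd height and all elements of \<open>V\<close> lie between 1 and
    \<open>m\<close>, so congruence would mean equality, against parity.\<close>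
  have odd: "e (Suc (2 * k)) = 0" if "k < T b" for k
  proof -
    have "\<not> [int (Suc (2 * k)) = int (2 * w)] (mod int m)" if "w \<in> W" for w
    proof
      assume "[int (Suc (2 * k)) = int (2 * w)] (mod int m)"
      then have "int m dvd int (Suc (2 * k)) - int (2 * w)"
        by (simp add: cong_iff_dvd_diff)
      moreover have "Suc (2 * k) \<le> m"
        using W[OF T_W] \<open>k < T b\<close> by simp
      ultimately have "int (Suc (2 * k)) = int (2 * w)"
        using W[OF that] by (intro eq_if_dvd_diff) auto
      then have "Suc (2 * k) = 2 * w"
        by (simp only: of_nat_eq_iff)
      then show False
        by presburger
    qed
    then show ?thesis
      by (simp add: e_def P_def allowed_height_def V)
  qed
  have even: "e (2 * k) = (if k \<in> W then 1 else 0)" if "0 < k" "k \<le> p" for k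
  proof -
    have "k = w" if "w \<in> W" "[int (2 * k) = int (2 * w)] (mod int m)" for w
    proof -
      have "int m dvd 2 * (int k - int w)"
        using that by (simp add: cong_iff_dvd_diff algebra_simps)
      then have "int p dvd int k - int w"
        by (rule dvd_double_imp_dvd_period[OF assms(6)])
      then have "int k = int w"
        using W[OF \<open>w \<in> W\<close>] \<open>0 < k\<close> \<open>k \<le> p\<close> by (intro eq_if_dvd_diff) auto
      then show ?thesis by simp
    qed
    then show ?thesis
      by (auto simp: e_def P_def allowed_height_def V)
  qed
  have T_mono: "T i \<le> T j" if "i \<le> j" for i j
    unfolding T_def using that by (intro add_left_mono sum_mono2) auto
  have W_le: "w \<le> T b" if "w \<in> W" for w
    using that T_mono by (auto simp: W_def)

  have h_b: "seq_h t b = 0" and h_nz: "\<And>j. j \<in> {1..<b} \<Longrightarrow> seq_h t j \<noteq> 0" and "b > 0"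
    using assms(7) by (auto simp: primitive_seq_def admissible_seq_def b_def)
  have "of_int (prim_cont t (Suc b)) = (0 :: rat)"
    using prim_cont_eq_prod[OF h_nz, of b b] h_b \<open>b > 0\<close> by (auto intro!: prod_zero bexI[of _ b])
  then have last: "prim_cont t (Suc b) = 0"
    by simp
  then have unit: "\<sigma> = 1 \<or> \<sigma> = - 1"
    using coprime_prim_cont[of t b] by (auto simp: \<sigma>_def)
  \<comment> \<open>The product stops just before the vanishing factor; by the sign, product -1
    corresponds to \<open>\<sigma> = 1\<close>.\<close>
  have "of_int (prim_cont t (Suc (l - 2))) = - (\<Prod>j=1..l - 2. seq_h t j)"
    by (rule prim_cont_eq_prod[OF h_nz]) (auto simp: b_def)
  moreover have "Suc (l - 2) = b"
    using assms(1) by (simp add: b_def)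
  ultimately have prod: "(\<Prod>j=1..l - 2. seq_h t j) = - of_int \<sigma>"
    by (simp add: \<sigma>_def)

  have rec: "hankel_rec (\<lambda>k. e (2 * k)) (Suc (T b)) = prim_cont t b \<and>
      hankel_rec (\<lambda>k. e (2 * k)) (T b) = prim_cont t b - prim_cont t (Suc b)"
    unfolding T_def
  proof (rule hankel_rec_prim_cont[where b = b])
    fix j assume "j \<le> b"
    then have "T j \<in> W"
      by (simp add: W_def)
    then show "e (2 * (s + (\<Sum>i=1..j. t i))) = 1"
      using even[of "T j"] W[of "T j"] by (simp add: T_def)
  next
    fix k assume k: "0 < k" "k \<le> s + (\<Sum>i=1..b. t i)" "k \<notin> {s + (\<Sum>i=1..j. t i) | j. j \<le> b}"
    then have "k \<notin> W" "k \<le> T b"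
      by (auto simp: W_def T_def)
    then show "e (2 * k) = 0"
      using even[of k] W[OF T_W] k by simp
  qed (use assms(2,3) in \<open>auto simp: b_def\<close>)
  have "hankel_det (F 0) (Suc (n + p)) = \<sigma> * hankel_det (F (2 * p)) (Suc n)" for n
  proof (rule hankel_det_quasi_period[OF step odd])
    show "e (2 * k) = 0" if "T b < k" "k \<le> p" for k
      using even[of k] W_le[of k] that by force
    show "T b \<le> p"
      using W[OF T_W] by simp
  qed (use rec last in \<open>auto simp: \<sigma>_def\<close>)
  moreover have "F (2 * p) = F 0"
  proof -
    have "[h + 2 * int p = v] (mod int m) \<longleftrightarrow> [h = v] (mod int m)" for h v
    proof -
      have "h + 2 * int p - v = h - v + 2 * int p"
        by simp
      then show ?thesis
        using dvd_2p by (simp only: cong_iff_dvd_diff dvd_add_left_iff)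
    qed
    then show ?thesis
      by (simp add: F_def P_def allowed_height_def)
  qed
  moreover have F0: "restricted_dyck_fps m V = F 0"
    by (simp add: restricted_dyck_fps_eq F_def P_def)
  ultimately have quasi: "?H (n + p) = \<sigma> * ?H n" if "n \<ge> 1" for n
    using that by (cases n) simp_all
  have period_2p: "has_period (2 * p) ?H"
    unfolding has_period_def
  proof (intro allI impI)
    fix n :: nat assume "n \<ge> 1"
    then show "?H (n + 2 * p) = ?H n"
      using quasi[of n] quasi[of "n + p"] unit by (auto simp: mult_2 add.assoc)
  qed
  \<comment> \<open>Index 1 decides: \<open>?H 1 = 1\<close>, so \<open>\<sigma> = -1\<close> would
    give \<open>?H (1 + p) = -1\<close>.\<close>
  have period_p: "has_period p ?H \<longleftrightarrow> \<sigma> = 1"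
  proof
    assume "has_period p ?H"
    then have "?H (1 + p) = ?H 1"
      unfolding has_period_def by blast
    moreover have "?H 1 = 1"
      using peak_dyck_fps_nth_0 by (simp add: hankel_det_def F0 F_def det_single)
    ultimately show "\<sigma> = 1"
      using quasi[of 1] by simp
  qed (simp add: has_period_def quasi)
  show ?thesis
    using unit period_p period_2p prod by auto
qed

end
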